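(* Let $G$ be a graph with minimum degree $\delta(G)\geq 3$. Then $G$ is safely $3$-colorable if at least one of the following holds: (i) $G$ has at least three connected components; (ii) $G$ has two connected components with at least $6$ vertices each; (iii) $G$ has at least one connected component which has at least $9$ vertices and is not a double windmill.
   Context: Graphs are finite, simple and undirected. For $A\subset V(G)$, $G\backslash A$ denotes the graph obtained from $G$ by removing all vertices of $A$ and their incident edges. A graph $G$ is safely $3$-colorable if there is a function $\phi:V(G)\to\{1,2,3\}$ (not required to be a proper coloring) such that for every subset $A\subset V(G)$ with $|A|=2$: (1) $\{\phi(u):u\in A\}\neq\{1,2,3\}$; and (2) there is a connected component $H$ of $G\backslash A$ with $\{\phi(u):u\in V(H)\}=\{1,2,3\}$. A double windmill is a graph which, for some integer $l\geq 1$, is isomorphic to one of the following two graphs: take $l$ disjoint copies of $K_2$ and two additional central vertices $c_1,c_2$, each of which is adjacent to all $2l$ vertices of the $K_2$ copies; in the double windmill with adjacent centers $\overline{DW_l}$ the vertices $c_1,c_2$ are also adjacent to each other, and in the double windmill with non-adjacent centers $DW_l$ they are not. There are no other edges. *)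

theory Defs
  imports "Graph_Theory.Graph_Theory"
begin

(* Finite simple undirected graphs are modelled by the locale graph of Graph_Theory: finite
   symmetric digraphs without loops and parallel arcs, each edge uv being the pair of arcs
   u -> v and v -> u. The degree of a vertex is therefore its out_degree. *)

(* Unspecified for the graph without vertices, as Min {} is. *)
definition min_degree :: "('a, 'b) pre_digraph \<Rightarrow> nat" where
  "min_degree G = Min (out_degree G ` verts G)"

(* The library's connected excludes the graph without vertices, so components are nonempty. *)
definition components :: "('a, 'b) pre_digraph \<Rightarrow> ('a, 'b) pre_digraph set" where
  "components G = {H. pre_digraph.max_subgraph G connected H}"

definition del_vert_set :: "('a, 'b) pre_digraph \<Rightarrow> 'a set \<Rightarrow> ('a, 'b) pre_digraph" where
  "del_vert_set G A = G \<restriction> (verts G - A)"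

definition safely_3_colorable :: "('a, 'b) pre_digraph \<Rightarrow> bool" where
  "safely_3_colorable G \<longleftrightarrow>
     (\<exists>\<phi> :: 'a \<Rightarrow> nat. \<phi> ` verts G \<subseteq> {1, 2, 3} \<and>
       (\<forall>A. A \<subseteq> verts G \<and> card A = 2 \<longrightarrow>
          \<phi> ` A \<noteq> {1, 2, 3} \<and>
          (\<exists>H \<in> components (del_vert_set G A). \<phi> ` verts H = {1, 2, 3})))"

(* Blade i False and Blade i True are the two vertices of the i-th copy of K_2. *)
datatype windmill_vertex = Center bool | Blade nat bool

definition DW :: "nat \<Rightarrow> windmill_vertex pair_pre_digraph" where
  "DW l = \<lparr> pverts = range Center \<union> {Blade i b | i b. i < l},
            parcs = {(Blade i b, Blade i (\<not> b)) | i b. i < l}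
              \<union> {(Center c, Blade i b) | c i b. i < l}
              \<union> {(Blade i b, Center c) | c i b. i < l} \<rparr>"

definition DW_adj :: "nat \<Rightarrow> windmill_vertex pair_pre_digraph" where
  "DW_adj l = \<lparr> pverts = pverts (DW l),
                parcs = parcs (DW l) \<union> {(Center c, Center (\<not> c)) | c. True} \<rparr>"

definition double_windmill :: "('a, 'b) pre_digraph \<Rightarrow> bool" where
  "double_windmill G \<longleftrightarrow>
     (\<exists>l \<ge> 1. digraph_iso G (with_proj (DW_adj l)) \<or> digraph_iso G (with_proj (DW l)))"

end

theory Submission
  imports Defs
begin

text \<open>
  The proof rests on one observation.  Suppose that \<open>G\<close> contains three pairwise disjoint three-vertex
  paths.  Give the vertices of each of them the three different colours, and colour all other vertices
  arbitrarily.  A set of two vertices is disjoint from at least one of the paths.  After its removal,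
  this path lies inside a single component, which therefore has all three colours.  Hence it is enough
  to find three disjoint three-vertex paths; this is \<open>P3_packing_imp_safely_3_colorable\<close>.

  A component with minimum degree at least three has at least four vertices.  By Dirac's theorem
  (\<open>dirac_long_path\<close>) it has a path on at least \<open>min 7 n\<close> vertices, where \<open>n\<close> is its order.  Cutting
  this path into triples gives one three-vertex path in every component and two in every component of
  order at least six, which settles the cases of three components and of two components of order at least six.

  For a single component of order at least nine, suppose that there are no three disjoint three-vertex
  paths, and consider a longest path; it has at least seven vertices.
    \<^item> If there is a path \<open>a b c d e f g h\<close> on eight vertices, then any vertex off it can only be adjacent
      to \<open>c\<close>, \<open>f\<close> and one further vertex off it (\<open>outside_path8\<close>).  Exchanging such a vertex and its
      neighbour off the path for one of the pairs \<open>a b\<close>, \<open>d e\<close>, \<open>g h\<close> gives a new path of the same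
      kind, so all vertices other than \<open>c\<close> and \<open>f\<close> behave in this way, and the graph is a double
      windmill with centers \<open>c\<close> and \<open>f\<close> (\<open>path8_windmill\<close>).
    \<^item> If \<open>a b c d e f g\<close> is a longest path, then every vertex off it has exactly the neighbours \<open>b\<close>, \<open>d\<close>
      and \<open>f\<close> (\<open>outside_path7\<close>).  Two such vertices complete the path to three disjoint three-vertex
      paths, a contradiction (\<open>longest_path7_impossible\<close>).
\<close>

section \<open>Neighbourhoods and connected components\<close>

definition neighbours :: "('a, 'b) pre_digraph \<Rightarrow> 'a \<Rightarrow> 'a set" where
  "neighbours G v = {w. v \<rightarrow>\<^bsub>G\<^esub> w}"

lemma (in nomulti_digraph) card_neighbours: "card (neighbours G v) = out_degree G v"
proof -
  have "neighbours G v = head G ` out_arcs G v"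
    by (force simp: neighbours_def arcs_ends_conv)
  moreover have "inj_on (head G) (out_arcs G v)"
    by (rule inj_onI) (auto intro!: no_multi_arcs simp: arc_to_ends_def)
  ultimately show ?thesis
    by (simp add: card_image out_degree_def)
qed

lemma (in wf_digraph) neighbours_subset: "neighbours G v \<subseteq> verts G"
  by (auto simp: neighbours_def adj_in_verts)

lemma arc_mono_connected: "arc_mono connected"
  unfolding arc_mono_def
  by (metis spanning_def subgraphE wf_digraph.connected_spanning_imp_connected)

lemma (in sym_digraph) induced_connected_iff:
  assumes "induced_subgraph H G"
  shows "connected H \<longleftrightarrow> strongly_connected H"
proof -
  interpret H: wf_digraph H using assms by (rule wf_digraphI_induced)
  have sy: "symmetric H" using sym_arcs assms by (rule induced_graph_imp_symmetric)
  show ?thesis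
    using H.symmetric_connected_imp_strongly_connected[OF sy] 
    by (auto simp: connected_def strongly_connected_def sy H.reachable_mk_symmetric_eq)
qed

text \<open>
  The two notions compete for maximality among different subgraphs, since a connected subgraph may
  contain only one of the two arcs of an edge.  They agree because a maximal connected subgraph is
  induced, and induced subgraphs inherit symmetry.
\<close>
lemma (in sym_digraph) components_eq_sccs: "components G = sccs"
proof (intro set_eqI iffI)
  fix H assume "H \<in> components G"
  then have max: "max_subgraph connected H" by (simp add: components_def)
  then have "induced_subgraph H G"
    using arc_mono_connected by (rule induced_subgraphI_arc_mono)
  then have "strongly_connected H"
    using max induced_connected_iff max_subgraph_prop by blast
  moreover have "connected K" if "strongly_connected K" "subgraph K G" for K
  proof -
    have "(u, v) \<in> rtrancl_on (verts K) ((arcs_ends K)\<^sup>s)" if "u \<rightarrow>\<^sup>*\<^bsub>K\<^esub> v" for u v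
      using rtrancl_on_mono[OF _ subset_refl that[unfolded reachable_def]] by (auto simp: symcl_def)
    with that show ?thesis by (auto simp: connected_conv strongly_connected_def)
  qed
  ultimately have "max_subgraph strongly_connected H"
    using max by (auto simp: max_subgraph_def)
  then show "H \<in> sccs" by (simp add: sccs_altdef2)
next
  fix H assume H: "H \<in> sccs"
  then have ind: "induced_subgraph H G" by (rule in_sccs_imp_induced)
  show "H \<in> components G"
    unfolding components_def mem_Collect_eq
  proof (rule max_subgraphI)
    show "connected H" using H ind induced_connected_iff by (auto simp: sccs_def)
    show "subgraph H G" using ind by (rule induced_imp_subgraph)
  next
    fix K assume K: "H \<noteq> K" "subgraph H K" "subgraph K G"
    show "\<not> connected K"
    proof
      assume "connected K"
      moreover have "subgraph K (G \<restriction> verts K)"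
        using K(3) by (rule subgraph_induce_subgraphI2)
      moreover have "verts K = verts (G \<restriction> verts K)" by simp
      ultimately have "connected (G \<restriction> verts K)"
        using arc_mono_connected unfolding arc_mono_def by blast
      moreover have i: "induced_subgraph (G \<restriction> verts K) G"
        using K(3) by (intro induced_induce) auto
      ultimately have "strongly_connected (G \<restriction> verts K)"
        using induced_connected_iff by blast
      then have "\<not> verts H \<subset> verts K"
        using H i unfolding sccs_def by (metis (mono_tags, lifting) induce_subgraph_verts mem_Collect_eq)
      then have "verts H = verts K" using subgraph_imp_subverts[OF K(2)] by blast
      then have "H = K"
        using ind K(2,3) unfolding induced_subgraph_altdef2 max_subgraph_def by metis
      with K(1) show False by simp
    qed
  qed
qed

text \<open>
  A component is itself an instance of the locale, and it inherits the degree condition because no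
  edge leaves it; so the results on connected graphs below apply to each component separately.
\<close>
lemma (in graph) component_graph:
  assumes "H \<in> components G"
  shows "graph H" "connected H" "verts H \<subseteq> verts G"
    and "\<And>v. v \<in> verts H \<Longrightarrow> out_degree H v = out_degree G v"
    and "\<And>u v. u \<rightarrow>\<^bsub>H\<^esub> v \<Longrightarrow> u \<rightarrow>\<^bsub>G\<^esub> v"
proof -
  have scc: "H \<in> sccs" using assms by (simp add: components_eq_sccs)
  then have ind: "induced_subgraph H G" by (rule in_sccs_imp_induced)
  have ends: "tail H = tail G" "head H = head G"
    using ind by (auto simp: induced_subgraph_def subgraph_def compatible_def)
  show "graph H" 
    using digraphI_induced[OF ind] induced_graph_imp_symmetric[OF sym_arcs ind]
    by (rule digraph.graphI)
  show "connected H"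
    using assms max_subgraph_prop by (simp add: components_def)
  show "verts H \<subseteq> verts G" using ind by auto
  show "out_degree H v = out_degree G v" if "v \<in> verts H" for v
  proof -
    have "head G e \<in> verts H" if "e \<in> arcs G" "tail G e = v" for e
    proof -
      have "v \<rightarrow> head G e" using that by (auto simp: arcs_ends_conv)
      then have "v \<rightarrow>\<^sup>* head G e" "head G e \<rightarrow>\<^sup>* v" using graph_symmetric by auto
      moreover have "verts H \<in> sccs_verts" using scc by (simp add: sccs_verts_conv)
      ultimately show ?thesis
        using \<open>v \<in> verts H\<close> by (auto simp: in_sccs_verts_conv_reachable)
    qed
    with ind that have "out_arcs H v = out_arcs G v"
      by (auto simp: out_arcs_def induced_subgraph_def ends)
    then show ?thesis by (simp add: out_degree_def)
  qed
  show "u \<rightarrow>\<^bsub>G\<^esub> v" if "u \<rightarrow>\<^bsub>H\<^esub> v" for u v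
    using that ind by (auto simp: arcs_ends_conv ends induced_subgraph_def)
qed

lemma (in sym_digraph) connected_exits:
  assumes "connected G" "S \<subset> verts G" "S \<noteq> {}"
  obtains v w where "v \<in> S" "w \<notin> S" "v \<rightarrow> w"
proof -
  obtain u x where u: "u \<in> S" and x: "x \<in> verts G" "x \<notin> S" using assms by auto
  have "u \<rightarrow>\<^sup>* x"
    using assms u x symmetric_connected_imp_strongly_connected sym_arcs by blast
  then have "x \<in> S \<or> (\<exists>v \<in> S. \<exists>w. w \<notin> S \<and> v \<rightarrow> w)"
    by (induction rule: reachable_induct) (use u in blast)+
  with x that show ?thesis by blast
qed

section \<open>Long paths\<close>

definition is_path :: "('a, 'b) pre_digraph \<Rightarrow> 'a list \<Rightarrow> bool" where
  "is_path G xs \<longleftrightarrow>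
     xs \<noteq> [] \<and> distinct xs \<and> set xs \<subseteq> verts G \<and> successively (dominates G) xs"

lemma (in fin_digraph) longest_path:
  assumes "verts G \<noteq> {}"
  obtains xs where "is_path G xs" "\<And>ys. is_path G ys \<Longrightarrow> length ys \<le> length xs"
proof -
  obtain v where "v \<in> verts G" using assms by auto
  then have "is_path G [v]" by (simp add: is_path_def)
  moreover have "length ys \<le> card (verts G)" if "is_path G ys" for ys
    using that card_mono[OF finite_verts] unfolding is_path_def by (metis distinct_card)
  ultimately show thesis
    using ex_has_greatest_nat[of "is_path G" "[v]" length "Suc (card (verts G))"] that
    by (metis less_Suc_eq_le)
qed

text \<open>
  Some edge leaves the cycle; entering the cycle through it and walking once around collects all
  old vertices and a new one.
\<close>
lemma (in sym_digraph) extend_closed_path: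
  assumes "connected G" "is_path G ys" "last ys \<rightarrow> hd ys" "set ys \<noteq> verts G"
  obtains zs where "is_path G zs" "length zs = Suc (length ys)"
proof -
  obtain v w where vw: "v \<in> set ys" "w \<notin> set ys" "v \<rightarrow> w"
    using connected_exits[of "set ys"] assms by (auto simp: is_path_def)
  obtain as bs where ys: "ys = as @ v # bs" using split_list[OF vw(1)] by blast
  have "w \<rightarrow> v" "w \<in> verts G" using vw graph_symmetric adj_in_verts by auto
  then have "is_path G (w # v # bs @ as)"
    using assms(2,3) vw(2) unfolding is_path_def ys
    by (cases as) (auto simp: successively_append_iff successively_Cons hd_append split: if_splits)
  then show thesis using that by (force simp: ys)
qed

text \<open>
  Dirac's argument.  All neighbours of the two ends \<open>a\<close> and \<open>z\<close> of a longest path lie on it.  Record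
  the neighbours of \<open>a\<close> by the positions of their predecessors and those of \<open>z\<close> by their own
  positions.  If the path has at most \<open>2 * d\<close> vertices, these two sets of positions meet, and
  exchanging the edge after a common position for two new edges closes the path to a cycle on the
  same vertices.  In a connected graph the cycle, unless spanning, extends to a longer path.
\<close>
lemma (in graph) dirac_long_path:
  assumes con: "connected G" and deg: "\<And>v. v \<in> verts G \<Longrightarrow> d \<le> out_degree G v"
  obtains xs where "is_path G xs" "min (2 * d + 1) (card (verts G)) \<le> length xs"
proof -
  have "verts G \<noteq> {}" using con by (auto simp: connected_conv)
  then obtain xs where xs: "is_path G xs"
    and longest: "\<And>ys. is_path G ys \<Longrightarrow> length ys \<le> length xs"
    by (rule longest_path) blast
  define k where "k = length xs"
  define a z where "a = hd xs" and "z = last xs"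
  have nonempty: "xs \<noteq> []" and dist: "distinct xs" and sub: "set xs \<subseteq> verts G"
    and succ: "successively (dominates G) xs"
    using xs by (auto simp: is_path_def)
  have az: "a = xs ! 0" "z = xs ! (k - 1)" "0 < k" "a \<in> verts G" "z \<in> verts G"
    using nonempty sub by (auto simp: a_def z_def k_def hd_conv_nth last_conv_nth)
  have inside: "u \<in> set xs" if "a \<rightarrow> u \<or> z \<rightarrow> u" for u
  proof (rule ccontr)
    assume u: "u \<notin> set xs"
    have "is_path G (u # xs)" if "a \<rightarrow> u"
      using that u xs graph_symmetric adj_in_verts
      by (auto simp: is_path_def successively_Cons a_def)
    moreover have "is_path G (xs @ [u])" if "z \<rightarrow> u"
      using that u xs adj_in_verts
      by (auto simp: is_path_def successively_append_iff z_def)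
    ultimately show False using that longest by fastforce
  qed
  define I where "I = {i. i < k - 1 \<and> a \<rightarrow> xs ! Suc i}"
  define J where "J = {i. i < k - 1 \<and> z \<rightarrow> xs ! i}"
  have fin: "finite I" "finite J" by (simp_all add: I_def J_def)
  have "neighbours G a \<subseteq> (\<lambda>i. xs ! Suc i) ` I"
  proof
    fix u assume "u \<in> neighbours G a"
    then have u: "a \<rightarrow> u" by (simp add: neighbours_def)
    then obtain j where j: "j < k" "u = xs ! j" using inside by (metis in_set_conv_nth k_def)
    with u az have "j \<noteq> 0" using adj_not_same by metis
    then obtain i where "j = Suc i" by (cases j) auto
    with j u show "u \<in> (\<lambda>i. xs ! Suc i) ` I" by (auto simp: I_def)
  qed
  then have "d \<le> card I"
    using deg[OF az(4)] fin(1) by (metis card_neighbours le_trans surj_card_le)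
  moreover have "neighbours G z \<subseteq> (\<lambda>i. xs ! i) ` J"
  proof
    fix u assume "u \<in> neighbours G z"
    then have u: "z \<rightarrow> u" by (simp add: neighbours_def)
    then obtain j where j: "j < k" "u = xs ! j" using inside by (metis in_set_conv_nth k_def)
    with u az have "j \<noteq> k - 1" using adj_not_same by metis
    with j u show "u \<in> (\<lambda>i. xs ! i) ` J" by (auto simp: J_def)
  qed
  then have "d \<le> card J"
    using deg[OF az(5)] fin(2) by (metis card_neighbours le_trans surj_card_le)
  moreover have "card I + card J \<le> k - 1" if "I \<inter> J = {}"
  proof -
    have "card (I \<union> J) \<le> card {..<k - 1}" by (rule card_mono) (auto simp: I_def J_def)
    then show ?thesis using that fin by (simp add: card_Un_disjoint)
  qed
  moreover have "card (verts G) \<le> k" if ij: "I \<inter> J \<noteq> {}"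
  proof (rule ccontr)
    assume small: "\<not> card (verts G) \<le> k"
    obtain i where i: "Suc i < k" "a \<rightarrow> xs ! Suc i" "z \<rightarrow> xs ! i"
      using ij by (auto simp: I_def J_def less_diff_conv)
    \<comment> \<open>The path from \<open>a\<close> to position \<open>i\<close>, then by the edge to \<open>z\<close> backwards to position \<open>i + 1\<close>.\<close>
    define ys where "ys = take (Suc i) xs @ rev (drop (Suc i) xs)"
    have set_ys: "set ys = set xs"
      unfolding ys_def by (metis append_take_drop_id set_append set_rev)
    have pre: "successively (dominates G) (take (Suc i) xs)"
      and post: "successively (dominates G) (drop (Suc i) xs)"
      using succ by (metis append_take_drop_id successively_append_iff)+
    have post_rev: "successively (dominates G) (rev (drop (Suc i) xs))"
      unfolding successively_rev using post
      by (rule successively_mono) (rule graph_symmetric)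
    have ends: "last (take (Suc i) xs) = xs ! i" "hd (rev (drop (Suc i) xs)) = z"
      using i(1) nonempty
      by (simp_all add: k_def z_def take_Suc_conv_app_nth hd_rev)
    have ends': "last ys = xs ! Suc i" "hd ys = a"
      using i(1) nonempty
      by (simp_all add: k_def a_def ys_def last_rev hd_drop_conv_nth hd_append take_Suc)
    have "distinct ys"
      using dist unfolding ys_def by (simp add: set_take_disj_set_drop_if_distinct)
    moreover have "successively (dominates G) ys"
      unfolding ys_def successively_append_iff
      using pre post_rev ends(1,2) graph_symmetric[OF i(3)] by simp
    moreover have "ys \<noteq> []" using nonempty by (simp add: ys_def)
    ultimately have path: "is_path G ys"
      using sub set_ys by (simp add: is_path_def)
    have closed: "last ys \<rightarrow> hd ys" using ends' graph_symmetric[OF i(2)] by simp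
    have len: "length ys = k" using i(1) by (simp add: ys_def k_def)
    have "card (set ys) = k" using dist by (simp add: set_ys distinct_card k_def)
    with small have "set ys \<noteq> verts G" by auto
    then obtain zs where "is_path G zs" "length zs = Suc (length ys)"
      using extend_closed_path[OF con path closed] by blast
    then show False using longest[of zs] len by (simp add: k_def)
  qed
  ultimately have "min (2 * d + 1) (card (verts G)) \<le> length xs"
    using az(3) unfolding k_def by (cases "I \<inter> J = {}") linarith+
  with xs that show thesis by blast
qed

section \<open>Packings of three-vertex paths\<close>

definition P3 :: "('a, 'b) pre_digraph \<Rightarrow> 'a set \<Rightarrow> bool" where
  "P3 G S \<longleftrightarrow> (\<exists>x y z. S = {x, y, z} \<and> x \<noteq> z \<and> x \<rightarrow>\<^bsub>G\<^esub> y \<and> y \<rightarrow>\<^bsub>G\<^esub> z)"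

definition P3_packing :: "('a, 'b) pre_digraph \<Rightarrow> 'a set set \<Rightarrow> bool" where
  "P3_packing G F \<longleftrightarrow> (\<forall>S \<in> F. P3 G S) \<and> pairwise disjnt F"

lemma (in wf_digraph) P3_subset: "P3 G S \<Longrightarrow> S \<subseteq> verts G"
  by (auto simp: P3_def adj_in_verts)

lemma (in loopfree_digraph) card_P3: "P3 G S \<Longrightarrow> card S = 3"
proof -
  assume "P3 G S"
  then obtain x y z where S: "S = {x, y, z}" "x \<noteq> z" "x \<rightarrow> y" "y \<rightarrow> z" by (auto simp: P3_def)
  moreover have "x \<noteq> y" "y \<noteq> z" using S(3,4) adj_not_same by blast+
  ultimately show ?thesis by simp
qed

lemma (in fin_digraph) finite_P3_packing:
  assumes "P3_packing G F"
  shows "finite F"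
proof (rule finite_subset)
  show "F \<subseteq> Pow (verts G)" using assms P3_subset by (auto simp: P3_packing_def)
qed simp

text \<open>
  Consecutive triples of vertices of a path are disjoint paths.
\<close>
lemma P3_packing_of_path:
  assumes "distinct xs" "successively (dominates G) xs" "3 * m \<le> length xs"
  shows "\<exists>F. P3_packing G F \<and> finite F \<and> card F = m \<and> \<Union>F \<subseteq> set xs"
  using assms
proof (induction m arbitrary: xs)
  case 0
  show ?case by (rule exI[of _ "{}"]) (simp add: P3_packing_def)
next
  case (Suc m)
  then have "Suc (Suc (Suc 0)) \<le> length xs" by simp
  then obtain a b c ys where xs: "xs = a # b # c # ys"
    by (metis Suc_le_length_iff)
  obtain F where F: "P3_packing G F" "finite F" "card F = m" "\<Union>F \<subseteq> set ys"
    using Suc.IH[of ys] Suc.prems by (auto simp: xs successively_Cons)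
  have "P3 G {a, b, c}" using Suc.prems by (auto simp: xs P3_def)
  moreover have "disjnt {a, b, c} S" if "S \<in> F" for S
    using that F(4) Suc.prems(1) by (auto simp: xs disjnt_def)
  moreover have "{a, b, c} \<notin> F" using F(4) Suc.prems(1) by (auto simp: xs)
  ultimately have "P3_packing G (insert {a, b, c} F)" "card (insert {a, b, c} F) = Suc m"
    using F by (auto simp: P3_packing_def pairwise_insert disjnt_sym)
  then show ?case using F by (intro exI[of _ "insert {a, b, c} F"]) (auto simp: xs)
qed

lemma three_P3s:
  assumes "distinct [a, b, c, d, e, f, g, h, i]"
    and "a \<rightarrow>\<^bsub>G\<^esub> b" "b \<rightarrow>\<^bsub>G\<^esub> c" "d \<rightarrow>\<^bsub>G\<^esub> e" "e \<rightarrow>\<^bsub>G\<^esub> f" "g \<rightarrow>\<^bsub>G\<^esub> h" "h \<rightarrow>\<^bsub>G\<^esub> i"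
  shows "\<exists>F. P3_packing G F \<and> card F = 3"
proof (intro exI conjI)
  let ?F = "{{a, b, c}, {d, e, f}, {g, h, i}}"
  have "P3 G {a, b, c}" "P3 G {d, e, f}" "P3 G {g, h, i}"
    using assms by (auto simp: P3_def)
  moreover have "disjnt {a, b, c} {d, e, f}" "disjnt {a, b, c} {g, h, i}" "disjnt {d, e, f} {g, h, i}"
    using assms(1) by (auto simp: disjnt_def)
  ultimately show "P3_packing G ?F"
    unfolding P3_packing_def pairwise_insert by (auto simp: disjnt_sym)
  have "a \<notin> {d, e, f}" "a \<notin> {g, h, i}" "d \<notin> {g, h, i}" using assms(1) by auto
  then have "{a, b, c} \<noteq> {d, e, f}" "{a, b, c} \<noteq> {g, h, i}" "{d, e, f} \<noteq> {g, h, i}"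
    by blast+
  then show "card ?F = 3" by simp
qed

section \<open>Graphs without three disjoint three-vertex paths\<close>

text \<open>
  Every vertex other than the centers sees the two centers and one further vertex, necessarily its
  partner in a copy of \<open>K\<^sub>2\<close>.  Whether the centers are adjacent is left open, so both kinds of double
  windmill are covered.
\<close>
definition windmill_centers :: "('a, 'b) pre_digraph \<Rightarrow> 'a \<Rightarrow> 'a \<Rightarrow> bool" where
  "windmill_centers G c c' \<longleftrightarrow> c \<noteq> c' \<and> c \<in> verts G \<and> c' \<in> verts G \<and>
     (\<forall>v \<in> verts G - {c, c'}. \<exists>x \<in> verts G - {c, c'}. neighbours G v = {c, c', x})"

text \<open>
  The assumptions of the extremal analysis.  Most steps below refute a configuration by writing nine
  distinct vertices as three paths.
\<close>
locale P3_poor_graph = graph +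
  assumes deg3: "v \<in> verts G \<Longrightarrow> 3 \<le> out_degree G v"
    and no_packing: "\<not> (\<exists>F. P3_packing G F \<and> card F = 3)"
begin

lemma no_three_P3s:
  assumes "distinct [a, b, c, d, e, f, g, h, i]"
    and "a \<rightarrow> b" "b \<rightarrow> c" "d \<rightarrow> e" "e \<rightarrow> f" "g \<rightarrow> h" "h \<rightarrow> i"
  shows False
  using three_P3s[OF assms] no_packing by blast

lemma neighbours_eqI:
  assumes "v \<in> verts G" "neighbours G v \<subseteq> {x, y, z}"
  shows "neighbours G v = {x, y, z}"
proof (rule card_seteq)
  have "3 \<le> card (neighbours G v)" using assms(1) deg3 by (simp add: card_neighbours)
  then show "card {x, y, z} \<le> card (neighbours G v)"
    by (rule order_trans[rotated]) (simp add: card_insert_if)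
qed (use assms in auto)

text \<open>
  Applied with \<open>S\<close> the vertex set of a path: a vertex with at most two neighbours on the path and at
  most one off it can have degree three only by using all of them.
\<close>
lemma outside_neighbour:
  assumes w: "w \<in> verts G"
    and sub: "\<And>u. w \<rightarrow> u \<Longrightarrow> u \<in> S \<Longrightarrow> u = p \<or> u = q"
    and uniq: "\<And>x y. w \<rightarrow> x \<Longrightarrow> w \<rightarrow> y \<Longrightarrow> x \<notin> S \<Longrightarrow> y \<notin> S \<Longrightarrow> x = y"
  obtains x where "x \<notin> S" "x \<in> verts G" "w \<rightarrow> x" "neighbours G w = {p, q, x}"
proof -
  have "\<not> neighbours G w \<subseteq> {p, q}"
  proof
    assume "neighbours G w \<subseteq> {p, q}"
    then have "card (neighbours G w) \<le> card {p, q}" by (intro card_mono) auto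
    also have "\<dots> \<le> 2" by (simp add: card_insert_if)
    finally show False using deg3[OF w] by (simp add: card_neighbours)
  qed
  then obtain x where x: "w \<rightarrow> x" "x \<notin> S" using sub by (auto simp: neighbours_def)
  then have "neighbours G w \<subseteq> {p, q, x}" using sub uniq by (auto simp: neighbours_def)
  then have "neighbours G w = {p, q, x}" by (rule neighbours_eqI[OF w])
  then show thesis using x that adj_in_verts by blast
qed

text \<open>
  An edge from \<open>w\<close> to a vertex of the path other than the third and the sixth splits the nine vertices
  into three paths; for the fourth vertex \<open>d\<close>, say, into \<open>a b c\<close>, \<open>w d e\<close> and \<open>f g h\<close>.  Two neighbours
  off the path would form a third path beside \<open>a b c\<close> and \<open>d e f\<close>.
\<close>
lemma outside_path8:
  assumes path: "is_path G [a, b, c, d, e, f, g, h]"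
    and w: "w \<in> verts G" "w \<notin> {a, b, c, d, e, f, g, h}"
  obtains x where "x \<notin> {a, b, c, d, e, f, g, h}" "x \<in> verts G" "w \<rightarrow> x"
    "neighbours G w = {c, f, x}"
proof (rule outside_neighbour[OF w(1), of "{a, b, c, d, e, f, g, h}" c f])
  have dist: "distinct [w, a, b, c, d, e, f, g, h]" using path w by (auto simp: is_path_def)
  have E: "a \<rightarrow> b" "b \<rightarrow> c" "c \<rightarrow> d" "d \<rightarrow> e" "e \<rightarrow> f" "f \<rightarrow> g" "g \<rightarrow> h"
    using path by (auto simp: is_path_def)
  show "u = c \<or> u = f" if u: "w \<rightarrow> u" "u \<in> {a, b, c, d, e, f, g, h}" for u
  proof -
    note u' = graph_symmetric[OF u(1)]
    have "u \<noteq> a" using no_three_P3s[of w a b c d e f g h] dist E u(1) by auto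
    moreover have "u \<noteq> b" using no_three_P3s[of a b w c d e f g h] dist E u' by auto
    moreover have "u \<noteq> d" using no_three_P3s[of a b c w d e f g h] dist E u(1) by auto
    moreover have "u \<noteq> e" using no_three_P3s[of a b c d e w f g h] dist E u' by auto
    moreover have "u \<noteq> g" using no_three_P3s[of a b c d e f w g h] dist E u(1) by auto
    moreover have "u \<noteq> h" using no_three_P3s[of a b c d e f g h w] dist E u' by auto
    ultimately show ?thesis using u(2) by blast
  qed
  show "x = y" if xy: "w \<rightarrow> x" "w \<rightarrow> y" "x \<notin> {a, b, c, d, e, f, g, h}" "y \<notin> {a, b, c, d, e, f, g, h}" for x y
  proof (rule ccontr)
    assume "x \<noteq> y"
    moreover have "x \<noteq> w" "y \<noteq> w" using xy adj_not_same by auto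
    ultimately show False
      using no_three_P3s[of a b c d e f x w y] dist E graph_symmetric[OF xy(1)] xy by auto
  qed
qed (rule that)

text \<open>
  An outside vertex \<open>w\<close> and its outside neighbour \<open>x\<close> are both joined to \<open>c\<close> and \<open>f\<close>.  Hence the pair
  \<open>w x\<close> can replace each of the pairs \<open>a b\<close>, \<open>d e\<close> and \<open>g h\<close> of the path, which yields another
  eight-vertex path with the same third and sixth vertex that misses the replaced pair.  So what is
  known about outside vertices holds for the vertices of the path as well.
\<close>
lemma path8_windmill:
  assumes path: "is_path G [a, b, c, d, e, f, g, h]" and big: "9 \<le> card (verts G)"
  shows "windmill_centers G c f"
proof -
  have dist: "distinct [a, b, c, d, e, f, g, h]" and sub: "set [a, b, c, d, e, f, g, h] \<subseteq> verts G"
    using path by (auto simp: is_path_def)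
  have E: "a \<rightarrow> b" "b \<rightarrow> c" "c \<rightarrow> d" "d \<rightarrow> e" "e \<rightarrow> f" "f \<rightarrow> g" "g \<rightarrow> h"
    using path by (auto simp: is_path_def)
  have "set [a, b, c, d, e, f, g, h] \<noteq> verts G"
    using big distinct_card[OF dist] by auto
  then obtain w where w: "w \<in> verts G" "w \<notin> {a, b, c, d, e, f, g, h}" using sub by auto
  obtain x where x: "x \<notin> {a, b, c, d, e, f, g, h}" "x \<in> verts G" "w \<rightarrow> x"
    "neighbours G w = {c, f, x}"
    using outside_path8[OF path w] .
  have "w \<noteq> x" using x(3) adj_not_same by auto
  obtain y where y: "neighbours G x = {c, f, y}"
    using outside_path8[OF path x(2,1)] .
  have W: "w \<rightarrow> c" "w \<rightarrow> f" "x \<rightarrow> c" "x \<rightarrow> f"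
    using x(4) y by (auto simp: neighbours_def)
  note W' = W[THEN graph_symmetric] graph_symmetric[OF x(3)]
  let ?Q = "\<lambda>v. \<exists>z \<in> verts G - {c, f}. neighbours G v = {c, f, z}"
  have out: "?Q v" if "is_path G [a', b', c, d', e', f, g', h']" "v \<in> verts G"
    "v \<notin> {a', b', c, d', e', f, g', h'}" for v a' b' d' e' g' h'
    using outside_path8[OF that] by (metis DiffI insert_iff empty_iff)
  have "is_path G [a, b, c, w, x, f, g, h]" "is_path G [w, x, c, d, e, f, g, h]"
    "is_path G [a, b, c, d, e, f, w, x]"
    using dist sub w x \<open>w \<noteq> x\<close> E W W' by (auto simp: is_path_def)
  note new = this
  have "?Q v" if v: "v \<in> verts G - {c, f}" for v
  proof -
    consider "v \<in> {d, e}" | "v \<in> {a, b}" | "v \<in> {g, h}" | "v \<notin> {a, b, c, d, e, f, g, h}"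
      using v by blast
    then show ?thesis
    proof cases
      case 1
      then show ?thesis using out[OF new(1)] v dist w(2) x(1) by auto
    next
      case 2
      then show ?thesis using out[OF new(2)] v dist w(2) x(1) by auto
    next
      case 3
      then show ?thesis using out[OF new(3)] v dist w(2) x(1) by auto
    next
      case 4
      then show ?thesis using out[OF path] v by blast
    qed
  qed
  then show ?thesis using dist sub by (auto simp: windmill_centers_def)
qed

text \<open>
  If \<open>w\<close> had a neighbour \<open>x\<close> off the path, then \<open>w\<close> and \<open>x\<close> would both be joined to \<open>c\<close> and \<open>e\<close>, since
  other attachments give a path on eight vertices or three disjoint paths, and the detour
  \<open>a b c w x e f g\<close> would be too long.  So all neighbours of \<open>w\<close> lie on the path.  They are inner
  vertices, and no two of them are consecutive, because otherwise \<open>w\<close> could be added to the path at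
  an end or between them.
\<close>
lemma outside_path7:
  assumes path: "is_path G [a, b, c, d, e, f, g]"
    and longest: "\<And>ys. is_path G ys \<Longrightarrow> length ys \<le> 7"
    and w: "w \<in> verts G" "w \<notin> {a, b, c, d, e, f, g}"
  shows "neighbours G w = {b, d, f}"
proof -
  have dist: "distinct [w, a, b, c, d, e, f, g]" and sub: "{a, b, c, d, e, f, g} \<subseteq> verts G"
    using path w by (auto simp: is_path_def)
  have E: "a \<rightarrow> b" "b \<rightarrow> c" "c \<rightarrow> d" "d \<rightarrow> e" "e \<rightarrow> f" "f \<rightarrow> g"
    using path by (auto simp: is_path_def)
  have no8: False if "distinct [p, q, r, s, t, u, v, z]" "{p, q, r, s, t, u, v, z} \<subseteq> verts G"
    "p \<rightarrow> q" "q \<rightarrow> r" "r \<rightarrow> s" "s \<rightarrow> t" "t \<rightarrow> u" "u \<rightarrow> v" "v \<rightarrow> z" for p q r s t u v z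
    using longest[of "[p, q, r, s, t, u, v, z]"] that by (simp add: is_path_def)
  have ends: "\<not> v \<rightarrow> a" "\<not> v \<rightarrow> g" if v: "v \<in> verts G" "v \<notin> {a, b, c, d, e, f, g}" for v
    using no8[of v a b c d e f g] no8[of a b c d e f g v] dist sub E v graph_symmetric[of v g] by auto
  have inside: "x \<in> {a, b, c, d, e, f, g}" if x: "w \<rightarrow> x" for x
  proof (rule ccontr)
    assume xo: "x \<notin> {a, b, c, d, e, f, g}"
    have xv: "x \<in> verts G" "x \<rightarrow> w" "x \<noteq> w"
      using x adj_in_verts graph_symmetric adj_not_same by auto
    have nb: "\<exists>y. neighbours G u = {c, e, y}"
      if u: "u \<in> verts G" "u \<notin> {a, b, c, d, e, f, g}"
        and v: "u \<rightarrow> v" "v \<in> verts G" "v \<notin> {a, b, c, d, e, f, g}" for u v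
    proof (rule outside_neighbour[OF u(1), of "{a, b, c, d, e, f, g}" c e])
      have "u \<noteq> v" using v adj_not_same by auto
      show "y = c \<or> y = e" if y: "u \<rightarrow> y" "y \<in> {a, b, c, d, e, f, g}" for y
      proof -
        have "y \<noteq> b" using no8[of v u b c d e f g] dist sub E y(1) graph_symmetric[OF v(1)] u v \<open>u \<noteq> v\<close> by auto
        moreover have "y \<noteq> f" using no8[of a b c d e f u v] dist sub E graph_symmetric[OF y(1)] u v \<open>u \<noteq> v\<close> by auto
        moreover have "y \<noteq> d" using no_three_P3s[of a b c e f g d u v] dist E graph_symmetric[OF y(1)] u v \<open>u \<noteq> v\<close> by auto
        ultimately show ?thesis using y ends[OF u] by blast
      qed
      show "y = z" if yz: "u \<rightarrow> y" "u \<rightarrow> z" "y \<notin> {a, b, c, d, e, f, g}" "z \<notin> {a, b, c, d, e, f, g}" for y z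
      proof (rule ccontr)
        assume "y \<noteq> z"
        moreover have "y \<noteq> u" "z \<noteq> u" using yz adj_not_same by auto
        ultimately show False
          using no_three_P3s[of a b c d e f y u z] dist E graph_symmetric[OF yz(1)] yz u by auto
      qed
    qed blast
    have "w \<rightarrow> c" "x \<rightarrow> e"
      using nb[OF w x xv(1) xo] nb[OF xv(1) xo xv(2) w] by (auto simp: neighbours_def)
    then show False
      using no8[of a b c w x e f g] dist sub E w xo xv x graph_symmetric[of w c] by auto
  qed
  have nb: "neighbours G w \<subseteq> {b, c, d, e, f}"
    using inside ends[OF w] by (auto simp: neighbours_def)
  have bc: "\<not> (w \<rightarrow> b \<and> w \<rightarrow> c)"
    using no8[of a b w c d e f g] dist sub E w graph_symmetric[of w b] by auto
  have cd: "\<not> (w \<rightarrow> c \<and> w \<rightarrow> d)"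
    using no8[of a b c w d e f g] dist sub E w graph_symmetric[of w c] by auto
  have de: "\<not> (w \<rightarrow> d \<and> w \<rightarrow> e)"
    using no8[of a b c d w e f g] dist sub E w graph_symmetric[of w d] by auto
  have ef: "\<not> (w \<rightarrow> e \<and> w \<rightarrow> f)"
    using no8[of a b c d e w f g] dist sub E w graph_symmetric[of w e] by auto
  have "\<not> neighbours G w \<subseteq> {p, q}" for p q
  proof
    assume "neighbours G w \<subseteq> {p, q}"
    then have "card (neighbours G w) \<le> card {p, q}" by (intro card_mono) auto
    also have "\<dots> \<le> 2" by (simp add: card_insert_if)
    finally show False using deg3[OF w(1)] by (simp add: card_neighbours)
  qed
  from this[of b e] this[of c f] this[of c e] this[of b d] this[of d f] this[of b f]
  have "neighbours G w \<subseteq> {b, d, f}"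
    using nb bc cd de ef unfolding neighbours_def by blast
  then show ?thesis by (rule neighbours_eqI[OF w(1)])
qed

text \<open>
  Two outside vertices, both joined to \<open>b\<close>, \<open>d\<close> and \<open>f\<close>, give the paths \<open>a b w\<close>, \<open>c d w'\<close> and
  \<open>e f g\<close>.
\<close>
lemma longest_path7_impossible:
  assumes path: "is_path G [a, b, c, d, e, f, g]" and big: "9 \<le> card (verts G)"
    and longest: "\<And>ys. is_path G ys \<Longrightarrow> length ys \<le> 7"
  shows False
proof -
  let ?P = "{a, b, c, d, e, f, g}"
  have dist: "distinct [a, b, c, d, e, f, g]" and sub: "?P \<subseteq> verts G"
    using path by (auto simp: is_path_def)
  have E: "a \<rightarrow> b" "b \<rightarrow> c" "c \<rightarrow> d" "d \<rightarrow> e" "e \<rightarrow> f" "f \<rightarrow> g"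
    using path by (auto simp: is_path_def)
  have "2 \<le> card (verts G - ?P)"
    using big sub distinct_card[OF dist] by (subst card_Diff_subset) auto
  then obtain w w' where w: "w \<in> verts G - ?P" "w' \<in> verts G - ?P" "w \<noteq> w'"
    by (metis card_le_Suc0_iff_eq finite_Diff finite_verts not_less_eq_eq numeral_2_eq_2)
  have "neighbours G w = {b, d, f}" "neighbours G w' = {b, d, f}"
    using outside_path7[OF path longest] w(1,2) by auto
  then have "w \<rightarrow> b" "w' \<rightarrow> d" by (auto simp: neighbours_def)
  then show False
    using no_three_P3s[of a b w c d w' e f g] dist w E
      graph_symmetric[of w b] graph_symmetric[of w' d] by auto
qed

theorem connected_imp_windmill_centers:
  assumes con: "connected G" and big: "9 \<le> card (verts G)"
  obtains c c' where "windmill_centers G c c'"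
proof -
  obtain xs where xs: "is_path G xs" "min (2 * 3 + 1) (card (verts G)) \<le> length xs"
    by (rule dirac_long_path[OF con deg3])
  show thesis
  proof (cases "\<exists>ys. is_path G ys \<and> 8 \<le> length ys")
    case True
    then obtain ys where ys: "is_path G ys" "8 \<le> length ys" by blast
    define zs where "zs = take 8 ys"
    have "is_path G zs"
    proof -
      have "successively (dominates G) (take 8 ys @ drop 8 ys)"
        using ys(1) by (simp add: is_path_def)
      then have "successively (dominates G) (take 8 ys)"
        by (simp add: successively_append_iff del: append_take_drop_id)
      then show ?thesis
        using ys set_take_subset[of 8 ys] by (auto simp: is_path_def zs_def)
    qed
    moreover have "length zs = 8" using ys by (simp add: zs_def)
    then obtain a b c d e f g h where "zs = [a, b, c, d, e, f, g, h]"
      by (auto simp: length_Suc_conv numeral_eq_Suc)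
    ultimately show thesis using path8_windmill big that by metis
  next
    case False
    then have short: "length ys \<le> 7" if "is_path G ys" for ys using that by force
    then have "length xs = 7" using xs big short[OF xs(1)] by linarith
    then obtain a b c d e f g where "xs = [a, b, c, d, e, f, g]"
      by (auto simp: length_Suc_conv numeral_eq_Suc)
    then show thesis using longest_path7_impossible[OF _ big short] xs(1) by blast
  qed
qed

end

section \<open>From packings to safe colourings\<close>

lemma colour_disjoint_family:
  fixes F :: "'a set set"
  assumes "pairwise disjnt F" "\<And>S. S \<in> F \<Longrightarrow> card S = 3"
  obtains \<phi> :: "'a \<Rightarrow> nat" where "range \<phi> \<subseteq> {1, 2, 3}" "\<And>S. S \<in> F \<Longrightarrow> \<phi> ` S = {1, 2, 3}"
proof -
  have "\<exists>h. bij_betw h S {1, 2, 3::nat}" if "S \<in> F" for S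
  proof (rule finite_same_card_bij)
    show "finite S" using assms(2)[OF that] card.infinite by force
  qed (simp_all add: assms(2)[OF that])
  then obtain h where h: "\<And>S. S \<in> F \<Longrightarrow> bij_betw (h S) S {1, 2, 3::nat}" by metis
  define \<phi> where "\<phi> v = (if v \<in> \<Union>F then h (THE S. S \<in> F \<and> v \<in> S) v else 1)" for v
  have \<phi>: "\<phi> v = h S v" if "S \<in> F" "v \<in> S" for v S
  proof -
    have "(THE T. T \<in> F \<and> v \<in> T) = S"
      using that assms(1) by (intro the_equality) (auto simp: pairwise_def disjnt_def)
    then show ?thesis using that by (auto simp: \<phi>_def)
  qed
  show thesis
  proof
    show img: "\<phi> ` S = {1, 2, 3}" if "S \<in> F" for S
      using \<phi>[OF that] bij_betw_imp_surj_on[OF h[OF that]] by (metis image_cong)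
    show "range \<phi> \<subseteq> {1, 2, 3}"
    proof
      fix k assume "k \<in> range \<phi>"
      then obtain v where k: "k = \<phi> v" by blast
      show "k \<in> {1, 2, 3}"
      proof (cases "v \<in> \<Union>F")
        case True
        then show ?thesis using img k by blast
      qed (simp add: k \<phi>_def)
    qed
  qed
qed

lemma disjoint_family_avoids:
  assumes "pairwise disjnt F" "finite A" "card A < card F"
  obtains S where "S \<in> F" "S \<inter> A = {}"
proof (rule ccontr)
  assume "\<not> thesis"
  with that have "\<forall>S \<in> F. \<exists>a. a \<in> S \<inter> A" by blast
  then obtain f where f: "\<And>S. S \<in> F \<Longrightarrow> f S \<in> S \<inter> A" by metis
  have "inj_on f F"
  proof (rule inj_onI)
    fix S T assume "S \<in> F" "T \<in> F" "f S = f T"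
    then show "S = T" using f[of S] f[of T] assms(1) by (auto simp: pairwise_def disjnt_def)
  qed
  moreover have "f ` F \<subseteq> A" using f by blast
  ultimately have "card F \<le> card A" using card_inj_on_le assms(2) by blast
  with assms(3) show False by simp
qed

lemma (in sym_digraph) P3_in_component:
  assumes "P3 G S"
  obtains H where "H \<in> components G" "S \<subseteq> verts H"
proof -
  obtain x y z where S: "S = {x, y, z}" "x \<rightarrow> y" "y \<rightarrow> z" using assms by (auto simp: P3_def)
  then have v: "x \<in> verts G" "y \<in> verts G" "z \<in> verts G" using adj_in_verts by blast+
  show thesis
  proof
    show "G \<restriction> {v. y \<rightarrow>\<^sup>* v} \<in> components G"
      using induce_reachable_is_in_sccs[OF v(2)] by (simp add: components_eq_sccs)
    show "S \<subseteq> verts (G \<restriction> {v. y \<rightarrow>\<^sup>* v})"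
      using S v graph_symmetric[OF S(2)] by auto
  qed
qed

text \<open>
  Colour each of the three paths with all three colours.  Two deleted vertices meet at most two of
  the paths, so at least one survives as a connected subgraph, and the component that contains it has
  all colours.
\<close>
lemma (in graph) P3_packing_imp_safely_3_colorable:
  assumes F: "P3_packing G F" and three: "3 \<le> card F"
  shows "safely_3_colorable G"
proof -
  have disj: "pairwise disjnt F" and P3: "\<And>S. S \<in> F \<Longrightarrow> P3 G S"
    using F by (auto simp: P3_packing_def)
  obtain \<phi> :: "'a \<Rightarrow> nat" where \<phi>: "range \<phi> \<subseteq> {1, 2, 3}"
    and rainbow: "\<And>S. S \<in> F \<Longrightarrow> \<phi> ` S = {1, 2, 3}"
    using colour_disjoint_family[OF disj card_P3[OF P3]] by blast
  have "\<phi> ` A \<noteq> {1, 2, 3} \<and> (\<exists>H \<in> components (del_vert_set G A). \<phi> ` verts H = {1, 2, 3})"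
    if A: "A \<subseteq> verts G" "card A = 2" for A
  proof
    have "finite A" using A(1) finite_verts by (rule finite_subset)
    then have "card (\<phi> ` A) \<le> 2" using card_image_le[of A \<phi>] A(2) by simp
    then show "\<phi> ` A \<noteq> {1, 2, 3}" by auto
    obtain S where S: "S \<in> F" "S \<inter> A = {}"
      using disjoint_family_avoids[OF disj \<open>finite A\<close>] A(2) three by auto
    let ?D = "del_vert_set G A"
    have ind: "induced_subgraph ?D G" unfolding del_vert_set_def by (rule induced_induce) auto
    interpret D: sym_digraph ?D
      using wf_digraphI_induced[OF ind] induced_graph_imp_symmetric[OF sym_arcs ind]
      by (rule wf_digraph.sym_digraphI)
    have "u \<rightarrow>\<^bsub>?D\<^esub> v" if uv: "u \<rightarrow> v" "u \<notin> A" "v \<notin> A" for u v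
    proof -
      obtain e where "e \<in> arcs G" "tail G e = u" "head G e = v" using uv(1) by (rule reachableE)
      with A uv(2,3) show ?thesis by (auto simp: arcs_ends_conv del_vert_set_def)
    qed
    moreover obtain x y z where "S = {x, y, z}" "x \<noteq> z" "x \<rightarrow> y" "y \<rightarrow> z"
      using P3[OF S(1)] by (auto simp: P3_def)
    ultimately have "P3 ?D S" using S(2) unfolding P3_def by (metis disjoint_iff insertCI)
    then obtain H where H: "H \<in> components ?D" "S \<subseteq> verts H"
      by (rule D.P3_in_component)
    have "\<phi> ` verts H = {1, 2, 3}"
    proof
      show "\<phi> ` verts H \<subseteq> {1, 2, 3}" using \<phi> by blast
      show "{1, 2, 3} \<subseteq> \<phi> ` verts H" using rainbow[OF S(1)] H(2) by blast
    qed
    with H(1) show "\<exists>H \<in> components ?D. \<phi> ` verts H = {1, 2, 3}" by blast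
  qed
  then show ?thesis using \<phi> unfolding safely_3_colorable_def by blast
qed

lemma (in graph) components_disjoint:
  assumes "H \<in> components G" "K \<in> components G" "H \<noteq> K"
  shows "verts H \<inter> verts K = {}"
  using assms unfolding components_eq_sccs by (rule scc_disj)

lemma (in graph) union_P3_packings:
  assumes C: "finite C" "C \<subseteq> components G"
    and F: "\<And>H. H \<in> C \<Longrightarrow> P3_packing H (F H)"
  shows "P3_packing G (\<Union>H \<in> C. F H)" "card (\<Union>H \<in> C. F H) = (\<Sum>H \<in> C. card (F H))"
proof -
  have sub: "S \<subseteq> verts H" "S \<noteq> {}" if "H \<in> C" "S \<in> F H" for H S
  proof -
    interpret H: graph H using that C component_graph by blast
    have "P3 H S" using F that by (auto simp: P3_packing_def)
    then show "S \<subseteq> verts H" "S \<noteq> {}" using H.P3_subset by (auto simp: P3_def)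
  qed
  have apart: "disjnt S T" if "H \<in> C" "K \<in> C" "H \<noteq> K" "S \<in> F H" "T \<in> F K" for H K S T
  proof -
    have "verts H \<inter> verts K = {}" using components_disjoint[of H K] that(1-3) C(2) by auto
    then show ?thesis using sub(1)[OF that(1,4)] sub(1)[OF that(2,5)] by (auto simp: disjnt_def)
  qed
  show "P3_packing G (\<Union>H \<in> C. F H)"
    unfolding P3_packing_def
  proof
    show "\<forall>S \<in> (\<Union>H \<in> C. F H). P3 G S"
    proof
      fix S assume "S \<in> (\<Union>H \<in> C. F H)"
      then obtain H where H: "H \<in> C" "S \<in> F H" by blast
      then have "H \<in> components G" "P3 H S" using C F by (auto simp: P3_packing_def)
      then show "P3 G S" unfolding P3_def by (blast dest: component_graph(5))
    qed
    show "pairwise disjnt (\<Union>H \<in> C. F H)"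
    proof (rule pairwiseI)
      fix S T assume "S \<in> (\<Union>H \<in> C. F H)" "T \<in> (\<Union>H \<in> C. F H)" "S \<noteq> T"
      then obtain H K where HK: "H \<in> C" "S \<in> F H" "K \<in> C" "T \<in> F K" by blast
      show "disjnt S T"
      proof (cases "H = K")
        case True
        then show ?thesis using F[OF HK(1)] HK \<open>S \<noteq> T\<close> by (simp add: P3_packing_def pairwise_def)
      next
        case False
        with HK show ?thesis by (intro apart[of H K])
      qed
    qed
  qed
  show "card (\<Union>H \<in> C. F H) = (\<Sum>H \<in> C. card (F H))"
  proof (rule card_UN_disjoint[OF C(1)])
    show "\<forall>H \<in> C. finite (F H)"
    proof
      fix H assume "H \<in> C"
      then interpret H: graph H using C component_graph by blast
      show "finite (F H)" using F[OF \<open>H \<in> C\<close>] by (rule H.finite_P3_packing)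
    qed
    show "\<forall>H \<in> C. \<forall>K \<in> C. H \<noteq> K \<longrightarrow> F H \<inter> F K = {}"
    proof (intro ballI impI)
      fix H K assume "H \<in> C" "K \<in> C" "H \<noteq> K"
      then have "disjnt S T" if "S \<in> F H" "T \<in> F K" for S T using apart that by blast
      then show "F H \<inter> F K = {}" using sub(2)[OF \<open>H \<in> C\<close>] by (fastforce simp: disjnt_def)
    qed
  qed
qed

section \<open>Recognising double windmills\<close>

text \<open>
  The orbits of a fixed-point-free involution are numbered \<open>0, ..., l - 1\<close>, and the Boolean argument of
  \<open>g\<close> tells the two points of an orbit apart.  For the map that sends a blade vertex to its partner,
  this is the labelling of the blades used in double windmills.
\<close>
lemma enumerate_involution_pairs:
  fixes p :: "'a \<Rightarrow> 'a"
  assumes "finite W" "\<And>v. v \<in> W \<Longrightarrow> p v \<in> W" "\<And>v. v \<in> W \<Longrightarrow> p v \<noteq> v"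
    "\<And>v. v \<in> W \<Longrightarrow> p (p v) = v"
  shows "\<exists>(l :: nat) g. bij_betw (case_prod g) ({..<l} \<times> UNIV) W \<and> (\<forall>i < l. \<forall>b. p (g i b) = g i (\<not> b))"
  using assms
proof (induction W rule: finite_psubset_induct)
  case (psubset W)
  show ?case
  proof (cases "W = {}")
    case True
    then show ?thesis
      by (intro exI[of _ "0 :: nat"] exI[of _ "\<lambda>_ _. undefined"]) (simp add: bij_betw_def)
  next
    case False
    then obtain w where w: "w \<in> W" by blast
    note pw = psubset.prems(1)[OF w] psubset.prems(2)[OF w] psubset.prems(3)[OF w]
    let ?W = "W - {w, p w}"
    have "p v \<noteq> w" "p v \<noteq> p w" if "v \<in> ?W" for v
      using that psubset.prems(3)[of v] pw by auto
    then have "\<exists>(l :: nat) g. bij_betw (case_prod g) ({..<l} \<times> UNIV) ?W \<and> (\<forall>i < l. \<forall>b. p (g i b) = g i (\<not> b))"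
      using w psubset.prems by (intro psubset.IH) auto
    then obtain l :: nat and g where g: "bij_betw (case_prod g) ({..<l} \<times> UNIV) ?W"
      and pg: "\<And>i b. i < l \<Longrightarrow> p (g i b) = g i (\<not> b)" by blast
    define g' where "g' i b = (if i = l then if b then w else p w else g i b)" for i b
    have "bij_betw (case_prod g') ({..<l} \<times> UNIV) ?W"
      using g by (rule bij_betw_cong[THEN iffD1, rotated]) (auto simp: g'_def)
    moreover have "bij_betw (case_prod g') ({l} \<times> UNIV) {w, p w}"
      using pw(2) by (auto simp: bij_betw_def inj_on_def g'_def UNIV_bool image_def)
    ultimately have "bij_betw (case_prod g') ({..<l} \<times> UNIV \<union> {l} \<times> UNIV) (?W \<union> {w, p w})"
      by (rule bij_betw_combine) auto
    moreover have "{..<l} \<times> UNIV \<union> {l} \<times> UNIV = {..<Suc l} \<times> (UNIV :: bool set)"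
      by auto
    moreover have "?W \<union> {w, p w} = W" using w pw by auto
    moreover have "p (g' i b) = g' i (\<not> b)" if "i < Suc l" for i b
      using that pg pw(3) by (auto simp: g'_def)
    ultimately show ?thesis by metis
  qed
qed

text \<open>
  Without parallel arcs, an isomorphism is determined by its action on vertices.  The bijection runs
  from the concrete graph \<open>D\<close> to \<open>G\<close> since in this direction it can be defined by cases on the
  vertices of \<open>D\<close>.
\<close>
lemma (in nomulti_digraph) digraph_iso_with_projI:
  assumes g: "bij_betw g (pverts D) (verts G)" and D: "parcs D \<subseteq> pverts D \<times> pverts D"
    and arcs: "\<And>x y. x \<in> pverts D \<Longrightarrow> y \<in> pverts D \<Longrightarrow> g x \<rightarrow> g y \<longleftrightarrow> (x, y) \<in> parcs D"
  shows "digraph_iso G (with_proj D)"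
proof -
  define f where "f = the_inv_into (pverts D) g"
  have f: "bij_betw f (verts G) (pverts D)"
    unfolding f_def using g by (rule bij_betw_the_inv_into)
  have gf: "g (f v) = v" if "v \<in> verts G" for v
    using that g unfolding f_def by (rule f_the_inv_into_f_bij_betw[rotated])
  have fg: "f (g x) = x" if "x \<in> pverts D" for x
    using that g unfolding f_def bij_betw_def by (simp add: the_inv_into_f_f)
  have fv: "f v \<in> pverts D" if "v \<in> verts G" for v using bij_betwE[OF f] that by blast
  define h where "h = \<lparr>iso_verts = f, iso_arcs = \<lambda>e. (f (tail G e), f (head G e)),
    iso_head = snd, iso_tail = fst\<rparr>"
  have "inj_on (iso_arcs h) (arcs G)"
  proof (rule inj_onI)
    fix e e' assume e: "e \<in> arcs G" "e' \<in> arcs G" "iso_arcs h e = iso_arcs h e'"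
    then have "tail G e = tail G e'" "head G e = head G e'"
      using bij_betw_imp_inj_on[OF f] by (auto simp: h_def inj_on_def)
    then show "e = e'" using e no_multi_arcs by (simp add: arc_to_ends_def)
  qed
  then have "digraph_isomorphism h"
    using bij_betw_imp_inj_on[OF f] wf_digraph by (simp add: digraph_isomorphism_def h_def)
  moreover have "iso_arcs h ` arcs G = parcs D"
  proof (intro subset_antisym subsetI)
    fix xy assume "xy \<in> iso_arcs h ` arcs G"
    then obtain e where e: "e \<in> arcs G" "xy = (f (tail G e), f (head G e))" by (auto simp: h_def)
    then have "tail G e \<rightarrow> head G e" by (auto simp: arcs_ends_conv)
    then show "xy \<in> parcs D" using arcs[of "f (tail G e)" "f (head G e)"] e fv gf by simp
  next
    fix xy assume xy: "xy \<in> parcs D"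
    then obtain x y where [simp]: "xy = (x, y)" and v: "x \<in> pverts D" "y \<in> pverts D" using D by auto
    then have "g x \<rightarrow> g y" using arcs xy by simp
    then obtain e where "e \<in> arcs G" "tail G e = g x" "head G e = g y" by (rule reachableE)
    then show "xy \<in> iso_arcs h ` arcs G" using fg v by (force simp: h_def)
  qed
  then have "with_proj D = app_iso h G"
    using bij_betw_imp_surj_on[OF f] by (simp add: app_iso_def with_proj_def h_def)
  ultimately show ?thesis unfolding digraph_iso_def by blast
qed

lemma (in graph) windmill_centers_imp_double_windmill:
  assumes cen: "windmill_centers G c c'" and big: "3 \<le> card (verts G)"
  shows "double_windmill G"
proof -
  let ?W = "verts G - {c, c'}"
  have c: "c \<noteq> c'" "c \<in> verts G" "c' \<in> verts G"
    and "\<forall>v \<in> ?W. \<exists>x. x \<in> ?W \<and> neighbours G v = {c, c', x}"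
    using cen by (auto simp: windmill_centers_def)
  then obtain p where p: "\<And>v. v \<in> ?W \<Longrightarrow> p v \<in> ?W \<and> neighbours G v = {c, c', p v}"
    by metis
  have adj: "v \<rightarrow> u \<longleftrightarrow> u \<in> {c, c', p v}" if "v \<in> ?W" for v u
    using p[OF that] by (auto simp: neighbours_def)
  have inv: "p (p v) = v" if v: "v \<in> ?W" for v
  proof -
    have "p v \<rightarrow> v" using adj[OF v] graph_symmetric by blast
    then show ?thesis using adj[of "p v"] p[OF v] v by auto
  qed
  have neq: "p v \<noteq> v" if "v \<in> ?W" for v
    using adj[OF that, of v] adj_not_same by auto
  have "\<exists>(l :: nat) g. bij_betw (case_prod g) ({..<l} \<times> UNIV) ?W \<and> (\<forall>i < l. \<forall>b. p (g i b) = g i (\<not> b))"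
  proof (rule enumerate_involution_pairs)
    show "finite ?W" by simp
    show "p v \<in> ?W" if "v \<in> ?W" for v using p[OF that] by simp
    show "p v \<noteq> v" if "v \<in> ?W" for v using that by (rule neq)
    show "p (p v) = v" if "v \<in> ?W" for v using that by (rule inv)
  qed
  then obtain l :: nat and g where g: "bij_betw (case_prod g) ({..<l} \<times> UNIV) ?W"
    and pg: "\<And>i b. i < l \<Longrightarrow> p (g i b) = g i (\<not> b)" by blast
  define k where "k x = (case x of Center b \<Rightarrow> if b then c' else c | Blade i b \<Rightarrow> g i b)" for x
  have kW: "k (Blade i b) \<in> ?W" if "i < l" for i b
    using bij_betwE[OF g] that by (auto simp: k_def)
  have kinj: "k (Blade i b) = k (Blade j d) \<longleftrightarrow> i = j \<and> b = d" if "i < l" "j < l" for i j b d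
    using bij_betw_imp_inj_on[OF g] that by (auto simp: k_def inj_on_def)
  have kC: "k (Center b) = (if b then c' else c)" for b by (simp add: k_def)
  have kBC: "k (Blade i b) \<noteq> k (Center d)" if "i < l" for i b d
    using kW[OF that, of b] by (simp add: kC)
  have kCC: "k (Center b) = k (Center d) \<longleftrightarrow> b = d" for b d
    using c(1) by (auto simp: kC)
  have pv: "pverts (DW l) = range Center \<union> {Blade i b | i b. i < l}" "pverts (DW_adj l) = pverts (DW l)"
    by (simp_all add: DW_def DW_adj_def)
  have "0 < l"
  proof (rule ccontr)
    assume "\<not> 0 < l"
    then have "?W = {}" using g by (auto simp: bij_betw_def)
    then have "card (verts G) \<le> card {c, c'}" by (intro card_mono) auto
    then show False using big c(1) by simp
  qed
  have bij: "bij_betw k (pverts (DW l)) (verts G)"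
  proof (rule bij_betw_imageI)
    show "inj_on k (pverts (DW l))"
    proof (rule inj_onI)
      fix x y assume "x \<in> pverts (DW l)" "y \<in> pverts (DW l)" "k x = k y"
      then show "x = y"
        using kinj kBC kBC[symmetric] kCC unfolding pv by (cases x; cases y) auto
    qed
    have "k ` {Blade i b | i b. i < l} = case_prod g ` ({..<l} \<times> UNIV)"
      by (force simp: k_def)
    moreover have "k ` range Center = {c, c'}"
      by (simp add: UNIV_bool kC insert_commute)
    ultimately have "k ` pverts (DW l) = {c, c'} \<union> ?W"
      using bij_betw_imp_surj_on[OF g] by (simp only: pv image_Un)
    then show "k ` pverts (DW l) = verts G" using c by auto
  qed
  have BB: "k (Blade i b) \<rightarrow> k (Blade j d) \<longleftrightarrow> j = i \<and> d = (\<not> b)" if "i < l" "j < l" for i j b d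
  proof -
    have "p (k (Blade i b)) = k (Blade i (\<not> b))" using pg that by (simp add: k_def)
    then have "k (Blade i b) \<rightarrow> k (Blade j d) \<longleftrightarrow> k (Blade j d) \<in> {c, c', k (Blade i (\<not> b))}"
      using adj[OF kW[OF that(1)]] by simp
    also have "\<dots> \<longleftrightarrow> k (Blade j d) = k (Blade i (\<not> b))" using kW[OF that(2), of d] by simp
    finally show ?thesis using kinj that by simp
  qed
  have BC: "k (Blade i b) \<rightarrow> k (Center d)" if "i < l" for i b d
    using adj[OF kW[OF that]] by (auto simp: kC)
  note CB = BC[THEN graph_symmetric]
  have CC: "k (Center b) \<rightarrow> k (Center d) \<longleftrightarrow> c \<rightarrow> c' \<and> d = (\<not> b)" for b d
    by (cases b; cases d) (auto simp: kC dest: adj_not_same graph_symmetric)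
  show ?thesis
  proof (cases "c \<rightarrow> c'")
    case True
    have "digraph_iso G (with_proj (DW_adj l))"
    proof (rule digraph_iso_with_projI)
      show "bij_betw k (pverts (DW_adj l)) (verts G)" using bij by (simp add: pv)
      show "parcs (DW_adj l) \<subseteq> pverts (DW_adj l) \<times> pverts (DW_adj l)"
        by (auto simp: DW_adj_def DW_def)
      show "k x \<rightarrow> k y \<longleftrightarrow> (x, y) \<in> parcs (DW_adj l)"
        if "x \<in> pverts (DW_adj l)" "y \<in> pverts (DW_adj l)" for x y
        using that BB BC CB CC True unfolding pv
        by (cases x; cases y) (auto simp: DW_adj_def DW_def)
    qed
    then show ?thesis using \<open>0 < l\<close> unfolding double_windmill_def by (metis Suc_leI One_nat_def)
  next
    case False
    have "digraph_iso G (with_proj (DW l))"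
    proof (rule digraph_iso_with_projI[OF bij])
      show "parcs (DW l) \<subseteq> pverts (DW l) \<times> pverts (DW l)" by (auto simp: DW_def)
      show "k x \<rightarrow> k y \<longleftrightarrow> (x, y) \<in> parcs (DW l)"
        if "x \<in> pverts (DW l)" "y \<in> pverts (DW l)" for x y
        using that BB BC CB CC False unfolding pv
        by (cases x; cases y) (auto simp: DW_def)
    qed
    then show ?thesis using \<open>0 < l\<close> unfolding double_windmill_def by (metis Suc_leI One_nat_def)
  qed
qed

section \<open>Packings in components\<close>

text \<open>
  The bound \<open>m \<le> 2\<close> reflects that minimum degree three guarantees a path on seven vertices only.
\<close>
lemma (in graph) connected_P3_packing:
  assumes con: "connected G" and deg: "\<And>v. v \<in> verts G \<Longrightarrow> 3 \<le> out_degree G v"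
    and m: "m \<le> 2" "3 * m \<le> card (verts G)"
  obtains F where "P3_packing G F" "card F = m"
proof -
  obtain xs where xs: "is_path G xs" "min 7 (card (verts G)) \<le> length xs"
    using dirac_long_path[OF con deg] by auto
  with m have "3 * m \<le> length xs" by linarith
  then show thesis
    using P3_packing_of_path[of xs G m] xs(1) that by (auto simp: is_path_def)
qed

lemma (in graph) connected_three_P3s_or_double_windmill:
  assumes con: "connected G" and deg: "\<And>v. v \<in> verts G \<Longrightarrow> 3 \<le> out_degree G v"
    and big: "9 \<le> card (verts G)" and nodw: "\<not> double_windmill G"
  obtains F where "P3_packing G F" "card F = 3"
proof (rule ccontr)
  assume "\<not> thesis"
  with that deg interpret P3_poor_graph G by unfold_locales auto
  obtain c c' where "windmill_centers G c c'" using connected_imp_windmill_centers[OF con big] .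
  then show False using windmill_centers_imp_double_windmill big nodw by auto
qed

lemma (in graph) degree_lt_card:
  assumes "v \<in> verts G"
  shows "out_degree G v < card (verts G)"
proof -
  have "neighbours G v \<subset> verts G"
    using assms neighbours_subset adj_not_same by (auto simp: neighbours_def)
  then show ?thesis by (simp add: psubset_card_mono flip: card_neighbours)
qed

theorem theorem2:
  fixes G :: "('a, 'b) pre_digraph"
  assumes "graph G"
    and "min_degree G \<ge> 3"
    and "card (components G) \<ge> 3
      \<or> (\<exists>H1 \<in> components G. \<exists>H2 \<in> components G.
            H1 \<noteq> H2 \<and> card (verts H1) \<ge> 6 \<and> card (verts H2) \<ge> 6)
      \<or> (\<exists>H \<in> components G. card (verts H) \<ge> 9 \<and> \<not> double_windmill H)"
  shows "safely_3_colorable G"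
proof -
  interpret graph G by fact
  have deg: "3 \<le> out_degree G v" if "v \<in> verts G" for v
  proof -
    have "Min (out_degree G ` verts G) \<le> out_degree G v" using that by (intro Min_le) auto
    then show ?thesis using assms(2) by (simp add: min_degree_def)
  qed
  have degH: "3 \<le> out_degree H v" if "H \<in> components G" "v \<in> verts H" for H v
    using that deg component_graph(3,4)[OF that(1)] by auto
  have packing: "\<exists>F. P3_packing H F \<and> card F = m"
    if "H \<in> components G" "m \<le> 2" "3 * m \<le> card (verts H)" for H m
    using graph.connected_P3_packing[OF component_graph(1,2)[OF that(1)] degH[OF that(1)] that(2,3)]
    by blast
  \<comment> \<open>It suffices to find three paths in total, distributed over the components.\<close>
  have safe_if: "safely_3_colorable G"
    if C: "finite C" "C \<subseteq> components G" "3 \<le> (\<Sum>H \<in> C. m H)"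
      and F: "\<And>H. H \<in> C \<Longrightarrow> \<exists>F. P3_packing H F \<and> card F = m H" for C and m :: "_ \<Rightarrow> nat"
  proof -
    obtain F where F: "\<And>H. H \<in> C \<Longrightarrow> P3_packing H (F H) \<and> card (F H) = m H"
      using F by metis
    have "P3_packing G (\<Union>H \<in> C. F H)" "card (\<Union>H \<in> C. F H) = (\<Sum>H \<in> C. card (F H))"
      using union_P3_packings[OF C(1,2), of F] F by auto
    moreover have "(\<Sum>H \<in> C. card (F H)) = (\<Sum>H \<in> C. m H)" using F by simp
    ultimately show ?thesis using C(3) P3_packing_imp_safely_3_colorable by metis
  qed
  from assms(3) consider
    (three) "card (components G) \<ge> 3"
    | (two) H1 H2 where "H1 \<in> components G" "H2 \<in> components G" "H1 \<noteq> H2"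
        "card (verts H1) \<ge> 6" "card (verts H2) \<ge> 6"
    | (one) H where "H \<in> components G" "card (verts H) \<ge> 9" "\<not> double_windmill H"
    by blast
  then show ?thesis
  proof cases
    case three
    have "\<exists>F. P3_packing H F \<and> card F = 1" if H: "H \<in> components G" for H
    proof (rule packing[OF H])
      interpret H: graph H using H by (rule component_graph)
      obtain v where "v \<in> verts H" using component_graph(2)[OF H] by (auto simp: connected_conv)
      then show "3 * 1 \<le> card (verts H)" using degH[OF H] H.degree_lt_card[of v] by fastforce
    qed simp
    moreover have "finite (components G)" using three card.infinite by fastforce
    ultimately show ?thesis using three by (intro safe_if[of "components G" "\<lambda>_. 1"]) auto
  next
    case two
    then show ?thesis using packing[of _ 2] by (intro safe_if[of "{H1, H2}" "\<lambda>_. 2"]) auto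
  next
    case one
    have "\<exists>F. P3_packing H F \<and> card F = 3"
      using graph.connected_three_P3s_or_double_windmill[OF component_graph(1,2)[OF one(1)] degH[OF one(1)] one(2,3)]
      by blast
    then show ?thesis using one(1) by (intro safe_if[of "{H}" "\<lambda>_. 3"]) auto
  qed
qed

end
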